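(* Consider the online general knapsack problem with reservation in which the reservation cost of an item is proportional to its size, with reservation factor $\alpha>0$. For every $\varepsilon>0$ there is a constant $c>1$ such that Algorithm A (described in the context, run with parameter $c$) is $(2+\varepsilon)$-competitive in the non-strict sense, i.e., there exists a constant $\beta>0$ such that for every request sequence $S$, \[{\rm gain}_{\mathtt{OPT}}(S)\le (2+\varepsilon)\cdot {\rm gain}_{\mathtt{A}}(S)+\beta.\]
   Context: Online general knapsack with reservation: the knapsack has capacity $1$. Items $x=(s_x,v_x)$ with size $0<s_x\le 1$ and value $v_x> 0$ arrive one by one. When an item arrives, an online algorithm must immediately and irrevocably either pack it, reject it, or reserve it. After the whole sequence has arrived, the algorithm may pack any subset of the reserved items that fits into the knapsack together with the already packed items (total size at most $1$). Every reserved item incurs a reservation cost, paid regardless of whether the item is finally packed; in this setting the cost of reserving $x$ is $\alpha\cdot s_x$. The gain of an algorithm on a sequence $S$ is the total value of packed items minus the total reservation costs; ${\rm gain}_{\mathtt{OPT}}(S)$ is the maximum total value of a subset of items of $S$ of total size at most $1$. Notation: the density of an item is $d(x)=v_x/s_x$; for a set $X$ of items, $s(X)=\sum_{x\in X}s_x$, $v(X)=\sum_{x\in X}v_x$. Algorithm A (parameter $c>1$): maintain a set $R_s$ of reserved items, initially empty, and a number $d_\delta$, initially $0$. For each arriving item $x_k$: (1) if $d(x_k)\le\alpha$, reject $x_k$; (2) else if $s(R_s)<1$, reserve $x_k$ and perform the update below; (3) else if $d(x_k)\ge c\cdot d_\delta$, reserve $x_k$ and perform the update below; (4) else reject $x_k$.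 Update: set $R_s:=R_s\cup\{x_k\}$; then repeatedly let $x_\delta$ be a least dense item of $R_s$ and, if $s(R_s\setminus\{x_\delta\})\ge 1$, remove $x_\delta$ from $R_s$, until $s(R_s\setminus\{x_\delta\})<1$; then set $d_\delta$ to the density of a least dense item in $R_s$. (Items removed from $R_s$ remain reserved.) The algorithm never packs an item before the end; after the last item, it packs a maximum-value subset of all reserved items with total size at most $1$. *)

theory Defs
  imports Complex_Main
begin

text \<open>
  A request sequence is a list of items (size, value). Different requests may carry the same
  size and value, so the items of a sequence \<open>S\<close> are identified with their positions, and
  sets of items with sets of indices below \<open>length S\<close>.
\<close>

type_synonym item = "real \<times> real"

definition isize :: "item \<Rightarrow> real" where
  "isize x = fst x"

definition ival :: "item \<Rightarrow> real" where
  "ival x = snd x"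

definition dens :: "item \<Rightarrow> real" where
  "dens x = ival x / isize x"

definition request_sequence :: "item list \<Rightarrow> bool" where
  "request_sequence S \<longleftrightarrow> (\<forall>x \<in> set S. 0 < isize x \<and> isize x \<le> 1 \<and> 0 < ival x)"

definition total_size :: "item list \<Rightarrow> nat set \<Rightarrow> real" where
  "total_size S X = (\<Sum>i\<in>X. isize (S ! i))"

definition total_value :: "item list \<Rightarrow> nat set \<Rightarrow> real" where
  "total_value S X = (\<Sum>i\<in>X. ival (S ! i))"

definition packings :: "item list \<Rightarrow> nat set \<Rightarrow> nat set set" where
  "packings S X = {P. P \<subseteq> X \<and> total_size S P \<le> 1}"

definition gain_OPT :: "item list \<Rightarrow> real" where
  "gain_OPT S = Max (total_value S ` packings S {..<length S})"

text \<open>The gain for reserving the items in \<open>D\<close> and finally packing those in \<open>P\<close>.\<close>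

definition gain :: "real \<Rightarrow> item list \<Rightarrow> nat set \<Rightarrow> nat set \<Rightarrow> real" where
  "gain \<alpha> S D P = total_value S P - \<alpha> * total_size S D"

definition least_dense :: "item list \<Rightarrow> nat set \<Rightarrow> nat \<Rightarrow> bool" where
  "least_dense S R i \<longleftrightarrow> is_arg_min (\<lambda>j. dens (S ! j)) (\<lambda>j. j \<in> R) i"

text \<open>
  The algorithm does not specify which of several least dense items is chosen, nor which of
  several optimal packings. It is therefore modelled by relations that admit every choice.

  \<open>prune S R R'\<close>: the removal loop, started with the set \<open>R\<close>, may end with \<open>R'\<close>.
\<close>

inductive prune :: "item list \<Rightarrow> nat set \<Rightarrow> nat set \<Rightarrow> bool" for S where
  stop: "least_dense S R x \<Longrightarrow> total_size S (R - {x}) < 1 \<Longrightarrow> prune S R R"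
| remove: "least_dense S R x \<Longrightarrow> total_size S (R - {x}) \<ge> 1 \<Longrightarrow> prune S (R - {x}) R' \<Longrightarrow> prune S R R'"

text \<open>
  A state \<open>(R, d, D)\<close> consists of the set \<open>R\<^sub>s\<close>, the number \<open>d\<^sub>\<delta>\<close>, and the
  set of all items reserved so far, including those removed from \<open>R\<^sub>s\<close>.
\<close>

type_synonym state = "nat set \<times> real \<times> nat set"

inductive reserve :: "item list \<Rightarrow> nat \<Rightarrow> state \<Rightarrow> state \<Rightarrow> bool" for S k where
  "prune S (insert k R) R' \<Longrightarrow> least_dense S R' y \<Longrightarrow>
     reserve S k (R, d, D) (R', dens (S ! y), insert k D)"

inductive step :: "real \<Rightarrow> real \<Rightarrow> item list \<Rightarrow> nat \<Rightarrow> state \<Rightarrow> state \<Rightarrow> bool" for \<alpha> c S k where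
  reject_sparse: "dens (S ! k) \<le> \<alpha> \<Longrightarrow> step \<alpha> c S k (R, d, D) (R, d, D)"
| reserve_fill: "dens (S ! k) > \<alpha> \<Longrightarrow> total_size S R < 1 \<Longrightarrow>
    reserve S k (R, d, D) st' \<Longrightarrow> step \<alpha> c S k (R, d, D) st'"
| reserve_dense: "dens (S ! k) > \<alpha> \<Longrightarrow> total_size S R \<ge> 1 \<Longrightarrow> dens (S ! k) \<ge> c * d \<Longrightarrow>
    reserve S k (R, d, D) st' \<Longrightarrow> step \<alpha> c S k (R, d, D) st'"
| reject_full: "dens (S ! k) > \<alpha> \<Longrightarrow> total_size S R \<ge> 1 \<Longrightarrow> dens (S ! k) < c * d \<Longrightarrow>
    step \<alpha> c S k (R, d, D) (R, d, D)"

text \<open>\<open>run \<alpha> c S k st\<close>: \<open>st\<close> is a possible state after the first \<open>k\<close> requests.\<close>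

inductive run :: "real \<Rightarrow> real \<Rightarrow> item list \<Rightarrow> nat \<Rightarrow> state \<Rightarrow> bool" for \<alpha> c S where
  init: "run \<alpha> c S 0 ({}, 0, {})"
| arrive: "run \<alpha> c S k st \<Longrightarrow> k < length S \<Longrightarrow> step \<alpha> c S k st st' \<Longrightarrow> run \<alpha> c S (Suc k) st'"

definition outcome_A :: "real \<Rightarrow> real \<Rightarrow> item list \<Rightarrow> nat set \<Rightarrow> nat set \<Rightarrow> bool" where
  "outcome_A \<alpha> c S D P \<longleftrightarrow>
     (\<exists>R d. run \<alpha> c S (length S) (R, d, D)) \<and>
     is_arg_max (total_value S) (\<lambda>Q. Q \<in> packings S D) P"

text \<open>On every request sequence the algorithm has at least one outcome.\<close>

lemma least_dense_exists:
  assumes "finite R" "R \<noteq> {}"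
  shows "\<exists>x. least_dense S R x"
  using ex_is_arg_min_if_finite[OF assms] unfolding least_dense_def by blast

lemma prune_exists:
  assumes "finite R" "R \<noteq> {}"
  shows "\<exists>R'. prune S R R'"
  using assms
proof (induction "card R" arbitrary: R rule: less_induct)
  case less
  obtain x where x: "least_dense S R x"
    using least_dense_exists less.prems by blast
  show ?case
  proof (cases "total_size S (R - {x}) < 1")
    case True
    with x show ?thesis by (blast intro: prune.stop)
  next
    case False
    then have "R - {x} \<noteq> {}"
      unfolding total_size_def by (metis sum.empty zero_less_one)
    moreover have "card (R - {x}) < card R"
      using x less.prems by (intro card_Diff1_less) (auto simp: least_dense_def is_arg_min_def)
    ultimately obtain R' where "prune S (R - {x}) R'"
      using less by blast
    with x False show ?thesis by (metis not_less prune.remove)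
  qed
qed

lemma prune_subset: "prune S R R' \<Longrightarrow> R' \<subseteq> R \<and> R' \<noteq> {}"
  by (induction rule: prune.induct) (auto simp: least_dense_def is_arg_min_def)

lemma reserve_exists:
  assumes "finite R"
  shows "\<exists>R' d' D'. reserve S k (R, d, D) (R', d', D') \<and> finite R' \<and> D' = insert k D"
proof -
  obtain R' where R': "prune S (insert k R) R'"
    using prune_exists assms by blast
  then have "finite R'" "R' \<noteq> {}"
    using prune_subset[OF R'] assms by (auto intro: finite_subset)
  with R' show ?thesis
    using least_dense_exists[of R' S] by (blast intro: reserve.intros)
qed

lemma run_exists:
  assumes "k \<le> length S"
  shows "\<exists>R d D. run \<alpha> c S k (R, d, D) \<and> finite R \<and> finite D"
  using assms
proof (induction k)
  case 0
  show ?case using run.init by blast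
next
  case (Suc k)
  then obtain R d D where st: "run \<alpha> c S k (R, d, D)" "finite R" "finite D"
    by auto
  obtain R' d' D' where r: "reserve S k (R, d, D) (R', d', D')" "finite R'" "D' = insert k D"
    using reserve_exists st by blast
  have "step \<alpha> c S k (R, d, D) (R, d, D) \<or> step \<alpha> c S k (R, d, D) (R', d', D')"
    using r by (meson not_less step.intros)
  with st r Suc.prems show ?case
    by (metis Suc_le_lessD finite.insertI run.arrive)
qed

lemma outcome_A_exists: "\<exists>D P. outcome_A \<alpha> c S D P"
proof -
  obtain R d D where D: "run \<alpha> c S (length S) (R, d, D)" "finite D"
    using run_exists by blast
  have "finite (packings S D)" "{} \<in> packings S D"
    using D by (auto simp: packings_def total_size_def)
  then have "\<exists>P. is_arg_max (total_value S) (\<lambda>Q. Q \<in> packings S D) P"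
    using ex_is_arg_min_if_finite[of "packings S D" "\<lambda>Q. - total_value S Q"]
    by (auto simp: is_arg_min_def is_arg_max_def)
  with D show ?thesis unfolding outcome_A_def by blast
qed

end

theory Submission
  imports Defs
begin

text \<open>
  The relevant reserved items are those of \<open>R\<^sub>s\<close>, which form two packings: its least dense item and
  the rest. They beat any optimal packing up to the factor \<open>c\<close>, because everything outside
  \<open>R\<^sub>s\<close> has density at most \<open>c * d\<^sub>\<delta>\<close>; hence \<open>OPT \<le> 2 * c * v(P) + \<alpha>\<close>.

  The reserved items with density in \<open>[t, c * t)\<close> also form two packings, because when the last
  of them arrives, the reserved items of density at least \<open>t\<close> have total size below 1.
  With \<open>t = \<alpha> * c ^ n\<close> the cost of such a class is at most \<open>2 * \<alpha>\<close> and at most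
  \<open>2 * v(P) / c ^ n\<close>. Using the first bound for finitely many \<open>n\<close> and the second for
  the others, the total reservation cost is at most a constant plus a small fraction of \<open>v(P)\<close>.
\<close>

section \<open>Sizes, values and densities\<close>

lemma request_sequence_nth:
  assumes "request_sequence S" "i < length S"
  shows "0 < isize (S ! i)" "isize (S ! i) \<le> 1" "0 < ival (S ! i)"
  using assms nth_mem unfolding request_sequence_def by blast+

lemma total_size_mono:
  assumes "request_sequence S" "B \<subseteq> {..<length S}" "A \<subseteq> B"
  shows "total_size S A \<le> total_size S B"
  unfolding total_size_def
proof (rule sum_mono2)
  show "finite B" using assms(2) finite_subset by blast
  show "0 \<le> isize (S ! i)" if "i \<in> B - A" for i
    using that assms request_sequence_nth by (simp add: less_imp_le subset_iff)
qed (use assms in auto)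

lemma total_size_Un_le:
  assumes "request_sequence S" "A \<subseteq> {..<length S}" "B \<subseteq> {..<length S}"
  shows "total_size S (A \<union> B) \<le> total_size S A + total_size S B"
proof -
  have fin: "finite A" "finite B" using assms finite_subset by blast+
  have "total_size S (A \<union> B) = total_size S A + total_size S (B - A)"
    unfolding total_size_def using fin by (metis Diff_disjoint Un_Diff_cancel finite_Diff sum.union_disjoint)
  with total_size_mono[of S B "B - A"] assms show ?thesis by auto
qed

lemma total_value_mono:
  assumes "request_sequence S" "B \<subseteq> {..<length S}" "A \<subseteq> B"
  shows "total_value S A \<le> total_value S B"
  unfolding total_value_def
proof (rule sum_mono2)
  show "finite B" using assms(2) finite_subset by blast
  show "0 \<le> ival (S ! i)" if "i \<in> B - A" for i
    using that assms request_sequence_nth by (simp add: less_imp_le subset_iff)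
qed (use assms in auto)

lemma total_value_Un_le:
  assumes "request_sequence S" "A \<subseteq> {..<length S}" "B \<subseteq> {..<length S}"
  shows "total_value S (A \<union> B) \<le> total_value S A + total_value S B"
proof -
  have fin: "finite A" "finite B" using assms finite_subset by blast+
  have "total_value S (A \<union> B) = total_value S A + total_value S (B - A)"
    unfolding total_value_def using fin by (metis Diff_disjoint Un_Diff_cancel finite_Diff sum.union_disjoint)
  with total_value_mono[of S B "B - A"] assms show ?thesis by auto
qed

lemma ival_eq_dens_times_isize:
  assumes "request_sequence S" "i < length S"
  shows "ival (S ! i) = dens (S ! i) * isize (S ! i)"
  using request_sequence_nth(1)[OF assms] by (simp add: dens_def)

lemma total_value_le_dens_bound:
  assumes "request_sequence S" "A \<subseteq> {..<length S}" "\<And>i. i \<in> A \<Longrightarrow> dens (S ! i) \<le> b"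
  shows "total_value S A \<le> b * total_size S A"
  unfolding total_value_def total_size_def sum_distrib_left
proof (rule sum_mono)
  fix i assume i: "i \<in> A"
  then have "i < length S" using assms by auto
  moreover from this have "0 \<le> isize (S ! i)"
    using assms request_sequence_nth(1) by (simp add: less_imp_le)
  ultimately show "ival (S ! i) \<le> b * isize (S ! i)"
    using assms i by (simp add: ival_eq_dens_times_isize mult_right_mono)
qed

lemma total_value_ge_dens_bound:
  assumes "request_sequence S" "A \<subseteq> {..<length S}" "\<And>i. i \<in> A \<Longrightarrow> b \<le> dens (S ! i)"
  shows "b * total_size S A \<le> total_value S A"
  unfolding total_value_def total_size_def sum_distrib_left
proof (rule sum_mono)
  fix i assume i: "i \<in> A"
  then have "i < length S" using assms by auto
  moreover from this have "0 \<le> isize (S ! i)"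
    using assms request_sequence_nth(1) by (simp add: less_imp_le)
  ultimately show "b * isize (S ! i) \<le> ival (S ! i)"
    using assms i by (simp add: ival_eq_dens_times_isize mult_right_mono)
qed

lemma total_size_singleton_le:
  assumes "request_sequence S" "k < length S"
  shows "total_size S {k} \<le> 1"
  using request_sequence_nth(2)[OF assms] by (simp add: total_size_def)

section \<open>Invariants of a run\<close>

lemma least_dense_iff:
  "least_dense S R x \<longleftrightarrow> x \<in> R \<and> (\<forall>j\<in>R. dens (S ! x) \<le> dens (S ! j))"
  unfolding least_dense_def is_arg_min_linorder by auto

lemma prune_least_dense:
  "prune S R R' \<Longrightarrow> \<exists>x. least_dense S R' x \<and> total_size S (R' - {x}) < 1"
  by (induction rule: prune.induct) auto

lemma prune_full:
  "prune S R R' \<Longrightarrow> 1 \<le> total_size S R \<Longrightarrow> 1 \<le> total_size S R'"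
  by (induction rule: prune.induct) auto

text \<open>An item is removed only while it is least dense among those still present and the others
  have total size at least 1. The items that survive are among these others, and
  \<open>prune_full\<close> preserves the size bound through the remaining removals.\<close>

lemma prune_removed:
  assumes "prune S R R'" "i \<in> R - R'"
  shows "1 \<le> total_size S R' \<and> (\<forall>j\<in>R'. dens (S ! i) \<le> dens (S ! j))"
  using assms
proof (induction arbitrary: i rule: prune.induct)
  case (remove R x R')
  show ?case
  proof (cases "i = x")
    case True
    moreover have "1 \<le> total_size S R'" using remove.hyps(2,3) prune_full by blast
    moreover have "R' \<subseteq> R" using prune_subset[OF remove.hyps(3)] by blast
    ultimately show ?thesis using remove.hyps(1) unfolding least_dense_iff by blast
  qed (use remove in auto)
qed auto

text \<open>For \<open>t = \<alpha> * c ^ n\<close> with n = 0, 1, ... these half-open intervals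
  tile the densities from \<alpha> upwards.\<close>

definition density_class :: "real \<Rightarrow> item list \<Rightarrow> nat set \<Rightarrow> real \<Rightarrow> nat set" where
  "density_class c S D t = {i \<in> D. t \<le> dens (S ! i) \<and> dens (S ! i) < c * t}"

text \<open>The two sets may overlap: sizes and values are positive, so subadditivity suffices for
  the bounds below.\<close>

definition two_packings :: "item list \<Rightarrow> nat set \<Rightarrow> bool" where
  "two_packings S X \<longleftrightarrow> (\<exists>A B. X = A \<union> B \<and> total_size S A \<le> 1 \<and> total_size S B \<le> 1)"

lemma two_packings_total_size:
  assumes "request_sequence S" "X \<subseteq> {..<length S}" "two_packings S X"
  shows "total_size S X \<le> 2"
proof -
  obtain A B where AB: "X = A \<union> B" "total_size S A \<le> 1" "total_size S B \<le> 1"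
    using assms(3) unfolding two_packings_def by blast
  with total_size_Un_le[OF assms(1), of A B] assms(2) show ?thesis by simp
qed

lemma two_packings_total_value:
  assumes "request_sequence S" "X \<subseteq> D" "D \<subseteq> {..<length S}" "two_packings S X"
    and "\<And>Q. Q \<in> packings S D \<Longrightarrow> total_value S Q \<le> V"
  shows "total_value S X \<le> 2 * V"
proof -
  obtain A B where AB: "X = A \<union> B" "A \<in> packings S D" "B \<in> packings S D"
    using assms(2,4) unfolding two_packings_def packings_def by blast
  moreover from this have "A \<subseteq> {..<length S}" "B \<subseteq> {..<length S}"
    using assms(3) unfolding packings_def by blast+
  ultimately show ?thesis
    using total_value_Un_le[OF assms(1), of A B] assms(5)[of A] assms(5)[of B] by simp
qed

text \<open>The number \<open>d\<close> is tied to \<open>R\<close> only once \<open>R\<close> has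
  size at least 1, when the algorithm starts to consult it. Before that, the clause on
  \<open>D - R\<close> forces \<open>D = R\<close>, and the clause on rejected items says that
  nothing denser than \<alpha> has been lost.\<close>

definition invariant :: "real \<Rightarrow> real \<Rightarrow> item list \<Rightarrow> nat \<Rightarrow> state \<Rightarrow> bool" where
  "invariant \<alpha> c S k = (\<lambda>(R, d, D).
     R \<subseteq> D \<and> D \<subseteq> {..<k} \<and> (\<forall>i\<in>D. \<alpha> < dens (S ! i)) \<and>
     (\<forall>j<k. j \<notin> D \<longrightarrow> dens (S ! j) \<le> \<alpha> \<or> 1 \<le> total_size S R \<and> dens (S ! j) < c * d) \<and>
     (1 \<le> total_size S R \<longrightarrow> (\<exists>x. least_dense S R x \<and> d = dens (S ! x) \<and> total_size S (R - {x}) < 1)) \<and>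
     (\<forall>i\<in>D - R. 1 \<le> total_size S R \<and> (\<forall>j\<in>R. dens (S ! i) \<le> dens (S ! j))) \<and>
     (\<forall>t. two_packings S (density_class c S D t)))"

lemma invariant_reserve:
  assumes S: "request_sequence S" and c: "1 < c" and \<alpha>: "0 < \<alpha>" and k: "k < length S"
    and inv: "invariant \<alpha> c S k (R, d, D)" and dens: "\<alpha> < dens (S ! k)"
    and acc: "total_size S R < 1 \<or> c * d \<le> dens (S ! k)"
    and res: "reserve S k (R, d, D) st"
  shows "invariant \<alpha> c S (Suc k) st"
proof -
  obtain R' y where R': "prune S (insert k R) R'" "least_dense S R' y"
    and st: "st = (R', dens (S ! y), insert k D)"
    using res by (cases rule: reserve.cases) auto
  have RD: "R \<subseteq> D" and Dk: "D \<subseteq> {..<k}" and Da: "\<forall>i\<in>D. \<alpha> < dens (S ! i)"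
    and rej: "\<And>j. j < k \<Longrightarrow> j \<notin> D \<Longrightarrow> dens (S ! j) \<le> \<alpha> \<or> 1 \<le> total_size S R \<and> dens (S ! j) < c * d"
    and full: "1 \<le> total_size S R \<Longrightarrow> \<exists>x. least_dense S R x \<and> d = dens (S ! x) \<and> total_size S (R - {x}) < 1"
    and removed: "\<And>i. i \<in> D - R \<Longrightarrow> 1 \<le> total_size S R \<and> (\<forall>j\<in>R. dens (S ! i) \<le> dens (S ! j))"
    and classes: "\<And>t. two_packings S (density_class c S D t)"
    using inv unfolding invariant_def by auto
  have Dl: "D \<subseteq> {..<length S}" using Dk k by auto
  have R'R: "R' \<subseteq> insert k R" using prune_subset R' by blast
  have full': "1 \<le> total_size S R'" if "1 \<le> total_size S R"
  proof (rule prune_full[OF R'(1)])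
    have "total_size S R \<le> total_size S (insert k R)"
      using RD Dl k by (intro total_size_mono[OF S]) auto
    with that show "1 \<le> total_size S (insert k R)" by simp
  qed
  \<comment> \<open>Once \<open>R\<close> is full, the threshold cannot decrease: the old items have
    density at least \<open>d\<close>, and the new one at least \<open>c * d\<close>, which exceeds
    \<open>d\<close> because \<open>d\<close> is positive.\<close>
  have dR': "d \<le> dens (S ! j)" if j: "1 \<le> total_size S R" "j \<in> R'" for j
  proof -
    obtain x where x: "least_dense S R x" "d = dens (S ! x)" using full j(1) by blast
    then have "d \<le> c * d" using Da RD c \<alpha> by (fastforce simp: least_dense_iff)
    then show ?thesis using x j R'R acc by (fastforce simp: least_dense_iff)
  qed
  have y: "y \<in> R'" using R'(2) by (simp add: least_dense_iff)
  have 1: "dens (S ! j) \<le> \<alpha> \<or> 1 \<le> total_size S R' \<and> dens (S ! j) < c * dens (S ! y)"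
    if j: "j < Suc k" "j \<notin> insert k D" for j
  proof (cases "dens (S ! j) \<le> \<alpha>")
    case False
    then have *: "1 \<le> total_size S R" "dens (S ! j) < c * d" using rej[of j] j by auto
    moreover have "c * d \<le> c * dens (S ! y)" using dR'[OF *(1) y] c by simp
    ultimately show ?thesis using full' by auto
  qed simp
  \<comment> \<open>The item on which the loop stops and the item \<open>y\<close> that defines the
    new threshold may differ, but both are least dense and hence equally dense.\<close>
  have 2: "\<exists>x. least_dense S R' x \<and> dens (S ! y) = dens (S ! x) \<and> total_size S (R' - {x}) < 1"
  proof -
    obtain x where "least_dense S R' x" "total_size S (R' - {x}) < 1"
      using prune_least_dense R' by blast
    with R'(2) show ?thesis by (meson least_dense_iff order_antisym)
  qed
  have 3: "1 \<le> total_size S R' \<and> (\<forall>j\<in>R'. dens (S ! i) \<le> dens (S ! j))"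
    if i: "i \<in> insert k D - R'" for i
  proof (cases "i \<in> insert k R")
    case True
    then show ?thesis using prune_removed[OF R'(1)] i by blast
  next
    \<comment> \<open>Here \<open>i\<close> was removed earlier, so its density is at most the old
      \<open>d\<close>, which is a lower bound on \<open>R'\<close>.\<close>
    case False
    then have *: "1 \<le> total_size S R" "\<forall>j\<in>R. dens (S ! i) \<le> dens (S ! j)"
      using removed i by auto
    then obtain x where x: "least_dense S R x" "d = dens (S ! x)" using full by blast
    then have "dens (S ! i) \<le> d" using * by (auto simp: least_dense_iff)
    then show ?thesis using full' dR' * by fastforce
  qed
  have 4: "two_packings S (density_class c S (insert k D) t)" for t
  proof (cases "t \<le> dens (S ! k) \<and> dens (S ! k) < c * t")
    case False
    then have "density_class c S (insert k D) t = density_class c S D t"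
      by (auto simp: density_class_def)
    then show ?thesis using classes by simp
  next
    case True
    let ?A = "density_class c S D t"
    have AD: "?A \<subseteq> D" by (auto simp: density_class_def)
    \<comment> \<open>The class before the arrival of \<open>k\<close> fits into one packing, so
      that \<open>k\<close> alone can form the other.\<close>
    have A: "total_size S ?A \<le> 1"
    proof (cases "total_size S R < 1")
      case True
      then have "D = R" using removed RD by force
      then show ?thesis using total_size_mono[OF S Dl AD] True by simp
    next
      case False
      then obtain x where x: "least_dense S R x" "d = dens (S ! x)" "total_size S (R - {x}) < 1"
        using full by fastforce
      \<comment> \<open>Acceptance gives \<open>c * d \<le> dens (S ! k)\<close>, and membership of
        \<open>k\<close> in the class gives \<open>dens (S ! k) < c * t\<close>. Thus
        \<open>x\<close> and all items removed earlier lie below the class, which is therefore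
        contained in \<open>R - {x}\<close>.\<close>
      have "c * d < c * t" using False acc True by linarith
      then have "dens (S ! x) < t" using c x by simp
      then have "?A \<subseteq> R - {x}"
        using removed x by (fastforce simp: density_class_def least_dense_iff)
      then show ?thesis using total_size_mono[OF S, of "R - {x}" ?A] x RD Dl by fastforce
    qed
    have "density_class c S (insert k D) t = ?A \<union> {k}"
      using True by (auto simp: density_class_def)
    then show ?thesis
      using A total_size_singleton_le[OF S k] unfolding two_packings_def by blast
  qed
  have 5: "R' \<subseteq> insert k D" "insert k D \<subseteq> {..<Suc k}" "\<forall>i\<in>insert k D. \<alpha> < dens (S ! i)"
    using R'R RD Dk Da dens by auto
  show ?thesis
    unfolding st invariant_def using 1 2 3 4 5 by (simp del: insert_iff)
qed

lemma invariant_step: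
  assumes "request_sequence S" "1 < c" "0 < \<alpha>" "k < length S"
    and "invariant \<alpha> c S k st" "step \<alpha> c S k st st'"
  shows "invariant \<alpha> c S (Suc k) st'"
  using assms(6)
proof (cases rule: step.cases)
  case (reject_sparse R d D)
  then show ?thesis using assms(5) by (auto simp: invariant_def less_Suc_eq)
next
  case (reserve_fill R d D)
  then show ?thesis using invariant_reserve assms by blast
next
  case (reserve_dense R d D)
  then show ?thesis using invariant_reserve assms by blast
next
  case (reject_full R d D)
  then show ?thesis using assms(5) by (auto simp: invariant_def less_Suc_eq)
qed

lemma invariant_run:
  assumes "run \<alpha> c S k st" "request_sequence S" "1 < c" "0 < \<alpha>"
  shows "invariant \<alpha> c S k st"
  using assms
proof (induction rule: run.induct)
  case init
  have "two_packings S {}" by (auto simp: two_packings_def total_size_def)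
  then show ?case by (auto simp: invariant_def total_size_def density_class_def)
qed (use invariant_step in blast)

section \<open>The optimum and the reservation cost\<close>

text \<open>Items of density at most \<alpha> contribute at most \<alpha> to a packing. The denser
  ones are compared with \<open>R\<close> by exchanging \<open>H - R\<close> for
  \<open>R - H\<close>, which has at least the same size and loses at most a factor \<open>c\<close>
  in density.\<close>

lemma gain_OPT_le:
  assumes S: "request_sequence S" and c: "1 < c" and \<alpha>: "0 < \<alpha>"
    and inv: "invariant \<alpha> c S (length S) (R, d, D)"
    and V: "\<And>Q. Q \<in> packings S D \<Longrightarrow> total_value S Q \<le> V"
  shows "gain_OPT S \<le> 2 * c * V + \<alpha>"
proof -
  have RD: "R \<subseteq> D" and Dl: "D \<subseteq> {..<length S}" and Da: "\<forall>i\<in>D. \<alpha> < dens (S ! i)"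
    and rej: "\<And>j. j < length S \<Longrightarrow> j \<notin> D \<Longrightarrow> dens (S ! j) \<le> \<alpha> \<or> 1 \<le> total_size S R \<and> dens (S ! j) < c * d"
    and full: "1 \<le> total_size S R \<Longrightarrow> \<exists>x. least_dense S R x \<and> d = dens (S ! x) \<and> total_size S (R - {x}) < 1"
    and removed: "\<And>i. i \<in> D - R \<Longrightarrow> 1 \<le> total_size S R \<and> (\<forall>j\<in>R. dens (S ! i) \<le> dens (S ! j))"
    using inv unfolding invariant_def by auto
  have V0: "0 \<le> V" using V[of "{}"] by (simp add: packings_def total_size_def total_value_def)
  have bound: "total_value S Q \<le> 2 * c * V + \<alpha>" if Q: "Q \<in> packings S {..<length S}" for Q
  proof -
    define L where "L = {i \<in> Q. dens (S ! i) \<le> \<alpha>}"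
    define H where "H = {i \<in> Q. \<alpha> < dens (S ! i)}"
    have Ql: "Q \<subseteq> {..<length S}" and Qs: "total_size S Q \<le> 1" using Q by (auto simp: packings_def)
    have sub: "L \<subseteq> Q" "H \<subseteq> Q" "Q = H \<union> L" unfolding L_def H_def by auto
    then have Hs: "total_size S H \<le> 1" and Ls: "total_size S L \<le> 1"
      using total_size_mono[OF S Ql] Qs by (meson order_trans)+
    have Hl: "H \<subseteq> {..<length S}" and Ll: "L \<subseteq> {..<length S}" using sub Ql by auto
    have "total_value S L \<le> \<alpha> * total_size S L"
      by (rule total_value_le_dens_bound[OF S Ll]) (simp add: L_def)
    also have "\<dots> \<le> \<alpha>" using Ls \<alpha> by simp
    finally have L: "total_value S L \<le> \<alpha>" .
    have H: "total_value S H \<le> 2 * c * V"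
    proof (cases "total_size S R < 1")
      case True
      \<comment> \<open>With \<open>R\<close> not full, every item denser than \<alpha> is reserved,
        so \<open>H\<close> itself is a packing available to the algorithm.\<close>
      then have "H \<subseteq> D" using rej Hl by (force simp: H_def)
      then have "total_value S H \<le> V" using V Hs by (simp add: packings_def)
      also have "\<dots> \<le> (2 * c) * V" using V0 c mult_right_mono[of 1 "2 * c" V] by simp
      finally show ?thesis .
    next
      case False
      then obtain x where x: "least_dense S R x" "d = dens (S ! x)" "total_size S (R - {x}) < 1"
        using full by fastforce
      have xR: "x \<in> R" and dmin: "\<And>j. j \<in> R \<Longrightarrow> d \<le> dens (S ! j)"
        using x by (auto simp: least_dense_iff)
      have d0: "0 < d" using xR RD Da x \<alpha> by fastforce
      have Rl: "R \<subseteq> {..<length S}" using RD Dl by simp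
      have fin: "finite R" "finite H" using Rl Hl finite_subset by blast+
      have "R = (R - {x}) \<union> {x}" using xR by auto
      then have "two_packings S R"
        using x(3) total_size_singleton_le[OF S] xR Rl unfolding two_packings_def
        by (metis less_imp_le lessThan_iff subsetD)
      then have VR: "total_value S R \<le> 2 * V"
        by (rule two_packings_total_value[OF S RD Dl _ V])
      \<comment> \<open>An item outside \<open>R\<close> was either reserved and later removed, with
        density at most \<open>d\<close>, or rejected, with density below
        \<open>c * d\<close>.\<close>
      have out: "dens (S ! i) \<le> c * d" if "i \<in> H - R" for i
      proof (cases "i \<in> D")
        case True
        then have "dens (S ! i) \<le> d" using removed[of i] that x xR by auto
        also have "d \<le> c * d" using c d0 by simp
        finally show ?thesis .
      next
        case False
        then show ?thesis using rej[of i] that Hl by (fastforce simp: H_def)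
      qed
      have split: "f H = f (H - R) + f (H \<inter> R)" "f R = f (R - H) + f (H \<inter> R)"
        if "f = total_size S \<or> f = total_value S" for f
      proof -
        show "f H = f (H - R) + f (H \<inter> R)"
          using that fin sum.Int_Diff[of H _ R] by (auto simp: total_size_def total_value_def add.commute)
        show "f R = f (R - H) + f (H \<inter> R)"
          using that fin sum.Int_Diff[of R _ H]
          by (auto simp: total_size_def total_value_def add.commute Int_commute)
      qed
      \<comment> \<open>\<open>H\<close> has size at most 1 and \<open>R\<close> at least 1; cancel
        their common part.\<close>
      have sizes: "total_size S (H - R) \<le> total_size S (R - H)"
        using split[of "total_size S"] Hs False by simp
      have Vi: "0 \<le> total_value S (H \<inter> R)"
        using total_value_mono[OF S, of "H \<inter> R" "{}"] Hl by (auto simp: total_value_def)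
      have "total_value S (H - R) \<le> (c * d) * total_size S (H - R)"
        using Hl out by (intro total_value_le_dens_bound[OF S]) auto
      also have "\<dots> \<le> (c * d) * total_size S (R - H)"
        using sizes c d0 by (intro mult_left_mono) auto
      also have "\<dots> = c * (d * total_size S (R - H))" by simp
      also have "\<dots> \<le> c * total_value S (R - H)"
        using c Rl dmin by (intro mult_left_mono total_value_ge_dens_bound[OF S]) auto
      finally have "total_value S (H - R) \<le> c * total_value S (R - H)" .
      moreover have "total_value S (H \<inter> R) \<le> c * total_value S (H \<inter> R)"
        using c Vi mult_right_mono[of 1 c "total_value S (H \<inter> R)"] by simp
      ultimately have "total_value S H \<le> c * total_value S R"
        using split[of "total_value S"] by (simp add: distrib_left)
      also have "\<dots> \<le> c * (2 * V)" using VR c by simp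
      finally show ?thesis by simp
    qed
    show ?thesis using total_value_Un_le[OF S Hl Ll] sub(3) L H by simp
  qed
  have "finite (packings S {..<length S})" "{} \<in> packings S {..<length S}"
    by (auto simp: packings_def total_size_def)
  then show ?thesis unfolding gain_OPT_def using bound by (intro Max.boundedI) auto
qed

lemma reservation_cost_le:
  assumes S: "request_sequence S" and c: "1 < c" and \<alpha>: "0 < \<alpha>"
    and inv: "invariant \<alpha> c S (length S) (R, d, D)"
    and V: "\<And>Q. Q \<in> packings S D \<Longrightarrow> total_value S Q \<le> V"
  shows "\<alpha> * total_size S D \<le> 2 * \<alpha> * real n + 2 * V * (1 / c) ^ n / (1 - 1 / c)"
proof -
  have Dl: "D \<subseteq> {..<length S}" and Da: "\<forall>i\<in>D. \<alpha> < dens (S ! i)"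
    and classes: "\<And>t. two_packings S (density_class c S D t)"
    using inv unfolding invariant_def by auto
  have V0: "0 \<le> V" using V[of "{}"] by (simp add: packings_def total_size_def total_value_def)
  \<comment> \<open>\<open>below N\<close> is the union of the first \<open>N\<close> classes, so
    the cost can be bounded by induction on \<open>N\<close>.\<close>
  define below where "below N = {i \<in> D. dens (S ! i) < \<alpha> * c ^ N}" for N
  define cls where "cls N = density_class c S D (\<alpha> * c ^ N)" for N
  have sub: "below N \<subseteq> {..<length S}" "cls N \<subseteq> D" "cls N \<subseteq> {..<length S}" for N
    using Dl by (auto simp: below_def cls_def density_class_def)
  have below_Suc: "\<alpha> * total_size S (below (Suc N)) \<le> \<alpha> * total_size S (below N) + \<alpha> * total_size S (cls N)" for N
  proof -
    have "below (Suc N) \<subseteq> below N \<union> cls N"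
      by (auto simp: below_def cls_def density_class_def ac_simps)
    then have "total_size S (below (Suc N)) \<le> total_size S (below N \<union> cls N)"
      using sub by (intro total_size_mono[OF S]) auto
    also have "\<dots> \<le> total_size S (below N) + total_size S (cls N)"
      by (rule total_size_Un_le[OF S sub(1,3)])
    finally show ?thesis using \<alpha> by (simp flip: distrib_left)
  qed
  have cls_const: "\<alpha> * total_size S (cls N) \<le> 2 * \<alpha>" for N
    using two_packings_total_size[OF S sub(3)] classes \<alpha> by (simp add: cls_def)
  have cls_value: "\<alpha> * total_size S (cls N) \<le> 2 * V * (1 / c) ^ N" for N
  proof -
    \<comment> \<open>A dense class is cheap relative to its value, and that value is at most
      \<open>2 * V\<close> because the class splits into two packings.\<close>
    have "\<alpha> * c ^ N * total_size S (cls N) \<le> total_value S (cls N)"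
      by (rule total_value_ge_dens_bound[OF S sub(3)]) (auto simp: cls_def density_class_def)
    also have "\<dots> \<le> 2 * V"
      using classes by (intro two_packings_total_value[OF S sub(2) Dl _ V]) (auto simp: cls_def)
    finally show ?thesis using c by (simp add: power_one_over field_simps)
  qed
  have low: "\<alpha> * total_size S (below N) \<le> 2 * \<alpha> * real N" for N
  proof (induction N)
    case 0
    have "below 0 = {}" using Da by (force simp: below_def)
    then show ?case by (simp add: total_size_def)
  next
    case (Suc N)
    then show ?case using below_Suc[of N] cls_const[of N] by (simp add: algebra_simps)
  qed
  have high: "\<alpha> * total_size S (below (n + m)) \<le> 2 * \<alpha> * real n + 2 * V * (1 / c) ^ n * (\<Sum>j<m. (1 / c) ^ j)" for m
  proof (induction m)
    case 0
    show ?case using low[of n] by simp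
  next
    case (Suc m)
    then show ?case using below_Suc[of "n + m"] cls_value[of "n + m"]
      by (simp add: distrib_left power_add mult.assoc)
  qed
  have "finite D" using Dl finite_subset by blast
  \<comment> \<open>Finitely many reserved items have bounded density, so finitely many classes
    exhaust \<open>D\<close>; inserting 0 covers empty \<open>D\<close>.\<close>
  define M where "M = Max (insert 0 ((\<lambda>i. dens (S ! i)) ` D))"
  obtain N where N: "M / \<alpha> < c ^ N" using real_arch_pow[OF c] by blast
  have "dens (S ! i) < \<alpha> * c ^ (n + N)" if "i \<in> D" for i
  proof -
    have "dens (S ! i) \<le> M" unfolding M_def using \<open>finite D\<close> that by (intro Max_ge) auto
    also have "M < \<alpha> * c ^ N" using N \<alpha> by (simp add: field_simps)
    also have "\<dots> \<le> \<alpha> * c ^ (n + N)" using \<alpha> c by (simp add: power_increasing)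
    finally show ?thesis .
  qed
  then have "below (n + N) = D" by (auto simp: below_def)
  then have "\<alpha> * total_size S D \<le> 2 * \<alpha> * real n + 2 * V * (1 / c) ^ n * (\<Sum>j<N. (1 / c) ^ j)"
    using high[of N] by simp
  also have "(\<Sum>j<N. (1 / c) ^ j) \<le> 1 / (1 - 1 / c)"
  proof -
    have "(\<Sum>j<N. (1 / c) ^ j) = (1 - (1 / c) ^ N) / (1 - 1 / c)"
      using c by (simp add: sum_gp_strict)
    also have "\<dots> \<le> 1 / (1 - 1 / c)" using c by (intro divide_right_mono) auto
    finally show ?thesis .
  qed
  then have "2 * V * (1 / c) ^ n * (\<Sum>j<N. (1 / c) ^ j) \<le> 2 * V * (1 / c) ^ n * (1 / (1 - 1 / c))"
    using V0 c by (intro mult_left_mono) auto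
  finally show ?thesis by simp
qed

section \<open>Choice of the constants and conclusion\<close>

theorem theorem1:
  fixes \<alpha> \<epsilon> :: real
  assumes "\<alpha> > 0" and "\<epsilon> > 0"
  shows "\<exists>c>1. \<exists>\<beta>>0. \<forall>S. request_sequence S \<longrightarrow>
           (\<forall>D P. outcome_A \<alpha> c S D P \<longrightarrow>
              gain_OPT S \<le> (2 + \<epsilon>) * gain \<alpha> S D P + \<beta>)"
proof -
  \<comment> \<open>This gives \<open>2 * c = 2 + \<epsilon> / 2\<close>; the other half of
    \<epsilon> pays for reservations.\<close>
  define c where "c = 1 + \<epsilon> / 4"
  have c: "1 < c" using assms by (simp add: c_def)
  \<comment> \<open>the fraction of \<open>v(P)\<close> lost to reservation costs, chosen so that
    \<open>(2 + \<epsilon>) * (1 - \<delta>) = 2 * c\<close>\<close>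
  define \<delta> where "\<delta> = (\<epsilon> / 2) / (2 + \<epsilon>)"
  have \<delta>: "0 < \<delta>" "(2 + \<epsilon>) * \<delta> = \<epsilon> / 2" using assms by (simp_all add: \<delta>_def divide_simps)
  \<comment> \<open>The powers of \<open>1 / c\<close> tend to 0. The choice of \<open>n\<close>
    depends only on \<open>c\<close> and \<delta>, so \<beta> does not depend on the
    sequence.\<close>
  obtain n where n: "(1 / c) ^ n < \<delta> * (1 - 1 / c) / 2"
    using real_arch_pow_inv[of "\<delta> * (1 - 1 / c) / 2" "1 / c"] c \<delta> by auto
  \<comment> \<open>The first summand pays for the \<open>n\<close> lowest density classes, the
    second for the sparse items in the optimum.\<close>
  define \<beta> where "\<beta> = (2 + \<epsilon>) * (2 * \<alpha> * real n) + \<alpha>"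
  have \<beta>: "0 < \<beta>" using assms by (auto simp: \<beta>_def intro: add_nonneg_pos)
  have "gain_OPT S \<le> (2 + \<epsilon>) * gain \<alpha> S D P + \<beta>"
    if S: "request_sequence S" and out: "outcome_A \<alpha> c S D P" for S D P
  proof -
    let ?V = "total_value S P"
    obtain R d where run: "run \<alpha> c S (length S) (R, d, D)"
      and P: "is_arg_max (total_value S) (\<lambda>Q. Q \<in> packings S D) P"
      using out unfolding outcome_A_def by blast
    have V: "\<And>Q. Q \<in> packings S D \<Longrightarrow> total_value S Q \<le> ?V"
      using P by (auto simp: is_arg_max_linorder)
    have inv: "invariant \<alpha> c S (length S) (R, d, D)"
      using invariant_run[OF run S c assms(1)] .
    have V0: "0 \<le> ?V" using V[of "{}"] by (simp add: packings_def total_size_def total_value_def)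
    have "2 * (1 / c) ^ n / (1 - 1 / c) \<le> \<delta>" using n c by (simp add: field_simps)
    then have "?V * (2 * (1 / c) ^ n / (1 - 1 / c)) \<le> ?V * \<delta>"
      using V0 by (rule mult_left_mono)
    then have "\<alpha> * total_size S D \<le> 2 * \<alpha> * real n + ?V * \<delta>"
      using reservation_cost_le[OF S c assms(1) inv V, of n] by (simp add: mult_ac)
    then have "(2 + \<epsilon>) * (\<alpha> * total_size S D) \<le> (2 + \<epsilon>) * (2 * \<alpha> * real n + ?V * \<delta>)"
      using assms by (intro mult_left_mono) auto
    also have "\<dots> = (2 + \<epsilon>) * (2 * \<alpha> * real n) + ?V * ((2 + \<epsilon>) * \<delta>)"
      by (simp add: algebra_simps)
    finally have cost: "(2 + \<epsilon>) * (\<alpha> * total_size S D) \<le> \<beta> - \<alpha> + ?V * (\<epsilon> / 2)"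
      using \<delta> by (simp add: \<beta>_def)
    have "gain_OPT S \<le> 2 * c * ?V + \<alpha>"
      by (rule gain_OPT_le[OF S c assms(1) inv V])
    also have "\<dots> = (2 + \<epsilon>) * ?V - ?V * (\<epsilon> / 2) + \<alpha>" by (simp add: c_def algebra_simps)
    also have "\<dots> \<le> (2 + \<epsilon>) * ?V - (2 + \<epsilon>) * (\<alpha> * total_size S D) + \<beta>"
      using cost by simp
    also have "\<dots> = (2 + \<epsilon>) * gain \<alpha> S D P + \<beta>"
      unfolding gain_def by (simp add: right_diff_distrib)
    finally show ?thesis .
  qed
  with c \<beta> show ?thesis by blast
qed

end
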